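(* Let $X$ be a real normed space and let $\mathcal C,\mathcal K\subset X$ be co-radiant sets such that $$d_{\mathcal C}\,d_{\mathcal K}>0,\qquad \mathcal K\text{ is regular},\qquad \operatorname{cl\,co}(\mathcal C)\cap\operatorname{int}(\mathcal K)\neq\varnothing .$$ Assume that $(\operatorname{cone}(\mathcal C),\operatorname{cone}(\mathcal K))$ verifies the SSP. Then there exist $0<\alpha_1<\alpha_2<1$ and $f\in S_{X^*}$ such that: (a) $\lambda:=\inf\{f(y)-\alpha\|y\|:\ y\in\mathcal C,\ \alpha\in(\alpha_1,\alpha_2)\}>0$. (b) There exists $\eta_0>0$ such that, for every $\eta\in(0,\eta_0)$, $$f(y')-\alpha\|y'\|<\frac{\eta}{\eta_0}\lambda<\lambda<f(y)-\alpha\|y\|$$ for every $\alpha\in(\alpha_1,\alpha_2)$, every $y'\in X\setminus\operatorname{int}(\mathcal K(\eta))$, and every $y\in\operatorname{cl\,co}(\mathcal C)$.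
   Context: $X$ is a real normed space, $S_X$ its unit sphere, $B_X^\circ$ its open unit ball, $X^*$ its topological dual, $S_{X^*}$ the unit sphere of $X^*$ for the dual norm; $\operatorname{cl},\operatorname{int},\operatorname{bd},\operatorname{co}$ denote closure, interior, boundary, convex hull, and $\operatorname{cl\,co}$ the closed convex hull. A cone is a nonempty $C\subset X$ with $\alpha C\subset C$ for all $\alpha\ge 0$; cones are assumed nontrivial ($\{0_X\}\subsetneq C\subset X$) unless otherwise stated. $\operatorname{cone}(A):=\{\lambda a:\lambda\ge 0,\ a\in A\}$. SSP: a pair of cones $(C,K)$ verifies the strict separation property (SSP) if $0_X\notin\operatorname{cl}\bigl(\operatorname{co}(C\cap S_X)-\operatorname{co}((\operatorname{bd}K\cap S_X)\cup\{0_X\})\bigr)$. Co-radiant set: $\mathcal K\subset X$ with $\lambda x\in\mathcal K$ for all $x\in\mathcal K$, $\lambda\ge 1$; co-radiant sets are assumed nonempty with $0_X\notin\mathcal K$. For $\eta>0$, $\mathcal K(\eta):=\eta\mathcal K$. Norm-base: for $t>0$, $\mathcal K\cap tS_X$ is a norm-base of $\mathcal K$ if for every $x\in\mathcal K$ there exist $y\in\mathcal K\cap tS_X$ and $\lambda>0$ with $x=\lambda y$; $\mathcal K$ admits a norm-base if this holds for some $t>0$. Interior reductions: for a cone $K$ and $\varepsilon>0$, $K^{-\varepsilon}:=K\setminus\bigl(\operatorname{cone}((\operatorname{bd}K\cap S_X)+\varepsilon B_X^\circ)\setminus\{0_X\}\bigr)$ (a cone, possibly trivial). For co-radiant $\mathcal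 K$, $\mathcal K^{-\varepsilon}:=\mathcal K\cap(\operatorname{cone}(\mathcal K))^{-\varepsilon}$. $\mathcal K$ is regular if, for every $\varepsilon>0$ with $\mathcal K^{-\varepsilon}\neq\varnothing$, the set $\mathcal K^{-\varepsilon}$ admits a norm-base. Radial profile: $\rho_{\mathcal K}:S_X\to[0,+\infty]$, $\rho_{\mathcal K}(v):=\inf\{\lambda>0:\lambda v\in\mathcal K\}$ with $\inf\varnothing=+\infty$; $\operatorname{dom}(\rho_{\mathcal K}):=\{v\in S_X:\rho_{\mathcal K}(v)<+\infty\}$; $d_{\mathcal K}:=\inf_{v\in\operatorname{dom}(\rho_{\mathcal K})}\rho_{\mathcal K}(v)$. *)

theory Defs
  imports "HOL-Analysis.Analysis"
begin

text \<open>The cone generated by a set \<open>A\<close>, i.e. the set of all \<open>\<lambda> a\<close> with \<open>\<lambda> \<ge> 0\<close> and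
  \<open>a \<in> A\<close>, is the library's \<open>cone hull A\<close>; in particular the cone generated by the empty set is
  empty.\<close>

lemma cone_hull_eq_scalings:
  fixes A :: "'a::real_normed_vector set"
  shows "cone hull A = {l *\<^sub>R a | l a. 0 \<le> l \<and> a \<in> A}"
  by (rule cone_hull_expl)

text \<open>Minkowski sums and differences are written out as set comprehensions, since \<open>-\<close> on sets is
  set difference.\<close>

definition SSP :: "'a::real_normed_vector set \<Rightarrow> 'a set \<Rightarrow> bool" where
  "SSP C K \<longleftrightarrow>
     0 \<notin> closure {x - y | x y. x \<in> convex hull (C \<inter> sphere 0 1)
                          \<and> y \<in> convex hull ((frontier K \<inter> sphere 0 1) \<union> {0})}"

definition coradiant :: "'a::real_normed_vector set \<Rightarrow> bool" where
  "coradiant K \<longleftrightarrow> K \<noteq> {} \<and> 0 \<notin> K \<and> (\<forall>x\<in>K. \<forall>l\<ge>1. l *\<^sub>R x \<in> K)"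

definition is_norm_base :: "'a::real_normed_vector set \<Rightarrow> real \<Rightarrow> bool" where
  "is_norm_base K t \<longleftrightarrow> (\<forall>x\<in>K. \<exists>y \<in> K \<inter> sphere 0 t. \<exists>l>0. x = l *\<^sub>R y)"

definition admits_norm_base :: "'a::real_normed_vector set \<Rightarrow> bool" where
  "admits_norm_base K \<longleftrightarrow> (\<exists>t>0. is_norm_base K t)"

definition cone_reduction :: "real \<Rightarrow> 'a::real_normed_vector set \<Rightarrow> 'a set" where
  "cone_reduction e K =
     K - ((cone hull {x + e *\<^sub>R u | x u. x \<in> frontier K \<inter> sphere 0 1 \<and> u \<in> ball 0 1}) - {0})"

definition coradiant_reduction :: "real \<Rightarrow> 'a::real_normed_vector set \<Rightarrow> 'a set" where
  "coradiant_reduction e K = K \<inter> cone_reduction e (cone hull K)"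

definition coradiant_regular :: "'a::real_normed_vector set \<Rightarrow> bool" where
  "coradiant_regular K \<longleftrightarrow>
     (\<forall>e>0. coradiant_reduction e K \<noteq> {} \<longrightarrow> admits_norm_base (coradiant_reduction e K))"

text \<open>In \<^typ>\<open>ennreal\<close> the infimum of the empty set is \<open>\<infinity>\<close>, as required for directions that miss
  \<open>K\<close>. The profile is only meaningful on the unit sphere, to which \<open>profile_dom\<close> restricts.\<close>

definition radial_profile :: "'a::real_normed_vector set \<Rightarrow> 'a \<Rightarrow> ennreal" where
  "radial_profile K v = Inf {ennreal l | l. 0 < l \<and> l *\<^sub>R v \<in> K}"

definition profile_dom :: "'a::real_normed_vector set \<Rightarrow> 'a set" where
  "profile_dom K = {v \<in> sphere 0 1. radial_profile K v < \<infinity>}"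

definition profile_inf :: "'a::real_normed_vector set \<Rightarrow> ennreal" where
  "profile_inf K = (INF v\<in>profile_dom K. radial_profile K v)"

end

theory Submission
  imports Defs
begin

text \<open>The SSP says that the convex set of differences \<open>x - y\<close> stays at distance at least
  some \<open>\<delta> > 0\<close> from the origin, so the Hahn-Banach theorem gives a functional \<open>f\<close> of norm one and a
  \<open>\<beta> \<ge> 0\<close> with \<open>f x \<ge> (\<beta> + \<delta>) \<parallel>x\<parallel>\<close> on \<open>cone C\<close> and \<open>f y \<le> \<beta> \<parallel>y\<parallel>\<close> on the boundary of
  \<open>cone K\<close>. The constants \<open>\<alpha>\<^sub>1 < \<alpha>\<^sub>2\<close> are chosen strictly between \<open>\<beta>\<close> and \<open>\<beta> + \<delta> \<le> 1\<close>.
  Since points of \<open>C\<close> have norm at least \<open>d > 0\<close>, where \<open>d\<close> is the infimum of the radial profile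
  of \<open>C\<close>, the values \<open>f y - \<alpha> \<parallel>y\<parallel>\<close> on \<open>C\<close> are bounded below by \<open>(\<beta> + \<delta> - \<alpha>\<^sub>2) d > 0\<close>.
  The function \<open>f y - \<alpha> \<parallel>y\<parallel>\<close> is concave and continuous, so its lower bound on \<open>C\<close> passes to the
  closed convex hull; the bound is strict there because \<open>\<alpha>\<close> can still be increased a little.

  For the upper estimate, consider the open convex cone \<open>D = {z. f z > \<alpha>\<^sub>1 \<parallel>z\<parallel>}\<close>. It avoids not
  only the boundary of \<open>cone K\<close> but, since \<open>\<beta> < \<alpha>\<^sub>1\<close>, also the cone generated by a small
  neighbourhood of the unit vectors in that boundary. As \<open>D\<close> is connected and contains every point
  common to \<open>int K\<close> and the closed convex hull of \<open>C\<close>, it lies in an interior reduction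
  of \<open>cone K\<close> (\<open>superlevel_cone_subset_cone_reduction\<close>). Regularity of \<open>K\<close> then puts all
  points of \<open>D\<close> of norm greater than some \<open>t\<close> into \<open>int K\<close>
  (\<open>regular_coradiant_contains_far_points\<close>). Hence \<open>f z - \<alpha> \<parallel>z\<parallel> \<le> t\<close> for every \<open>z\<close>
  outside \<open>int K\<close>, and scaling by \<open>\<eta>\<close> shows that \<open>\<eta>\<^sub>0 = \<lambda> / (t + 1)\<close> works.\<close>

section \<open>Sublinear functionals and the Hahn-Banach theorem\<close>

text \<open>Demanding only one inequality for positive factors keeps the condition stable under infima;
  the inequality for \<open>1 / c\<close> yields the equality, see \<open>sublinear_scale\<close>.\<close>

definition sublinear :: "('a::real_vector \<Rightarrow> real) \<Rightarrow> bool" where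
  "sublinear q \<longleftrightarrow> (\<forall>x y. q (x + y) \<le> q x + q y) \<and> (\<forall>c>0. \<forall>x. q (c *\<^sub>R x) \<le> c * q x)"

lemma sublinear_add: "sublinear q \<Longrightarrow> q (x + y) \<le> q x + q y"
  by (simp add: sublinear_def)

lemma sublinear_zero:
  assumes "sublinear q" shows "q 0 = 0"
proof -
  have "q (c *\<^sub>R 0) \<le> c * q 0" if "c > 0" for c
    using assms that unfolding sublinear_def by blast
  from this[of 2] this[of "1/2"] show ?thesis by simp
qed

lemma sublinear_scale:
  assumes "sublinear q" "c \<ge> 0"
  shows "q (c *\<^sub>R x) = c * q x"
proof (cases "c = 0")
  case True
  then show ?thesis using sublinear_zero[OF assms(1)] by simp
next
  case False
  then have c: "c > 0" using assms by simp
  have "q (inverse c *\<^sub>R (c *\<^sub>R x)) \<le> inverse c * q (c *\<^sub>R x)"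
    using assms(1) c unfolding sublinear_def by (meson positive_imp_inverse_positive)
  then have "c * q x \<le> q (c *\<^sub>R x)"
    using c by (simp add: field_simps)
  moreover have "q (c *\<^sub>R x) \<le> c * q x"
    using assms(1) c unfolding sublinear_def by blast
  ultimately show ?thesis by simp
qed

lemma sublinear_uminus_ge: "sublinear q \<Longrightarrow> - q (- x) \<le> q x"
  using sublinear_add[of q x "- x"] sublinear_zero[of q] by simp

text \<open>The three infima needed below (over a chain, over a ray and over a cone) are sublinear for
  the same reason: sums and multiples of members of the family are dominated by other members.\<close>

lemma sublinear_INF:
  fixes g :: "'i \<Rightarrow> 'a::real_vector \<Rightarrow> real"
  assumes "I \<noteq> {}" and bdd: "\<And>x. bdd_below ((\<lambda>i. g i x) ` I)"
    and add: "\<And>i j x y. i \<in> I \<Longrightarrow> j \<in> I \<Longrightarrow> \<exists>k\<in>I. g k (x + y) \<le> g i x + g j y"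
    and scale: "\<And>i c x. i \<in> I \<Longrightarrow> c > 0 \<Longrightarrow> \<exists>k\<in>I. g k (c *\<^sub>R x) \<le> c * g i x"
  shows "sublinear (\<lambda>x. INF i\<in>I. g i x)"
proof -
  let ?u = "\<lambda>x. INF i\<in>I. g i x"
  have le: "?u x \<le> g i x" if "i \<in> I" for i x
    by (rule cINF_lower[OF bdd that])
  have "?u (x + y) \<le> ?u x + ?u y" for x y
  proof -
    have *: "?u (x + y) \<le> g i x + g j y" if "i \<in> I" "j \<in> I" for i j
      using add[OF that, of x y] le by (meson order_trans)
    have "?u (x + y) - g i x \<le> ?u y" if "i \<in> I" for i
      by (rule cINF_greatest[OF \<open>I \<noteq> {}\<close>]) (use *[OF that] in \<open>simp add: algebra_simps\<close>)
    then have "?u (x + y) - ?u y \<le> g i x" if "i \<in> I" for i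
      using that by (simp add: algebra_simps)
    then have "?u (x + y) - ?u y \<le> ?u x"
      by (rule cINF_greatest[OF \<open>I \<noteq> {}\<close>])
    then show ?thesis by simp
  qed
  moreover have "?u (c *\<^sub>R x) \<le> c * ?u x" if "c > 0" for c x
  proof -
    have "?u (c *\<^sub>R x) / c \<le> g i x" if "i \<in> I" for i
    proof -
      have "?u (c *\<^sub>R x) \<le> c * g i x"
        using scale[OF \<open>i \<in> I\<close> \<open>c > 0\<close>, of x] le by (meson order_trans)
      then show ?thesis using \<open>c > 0\<close> by (simp add: field_simps)
    qed
    then have "?u (c *\<^sub>R x) / c \<le> ?u x"
      by (rule cINF_greatest[OF \<open>I \<noteq> {}\<close>])
    then show ?thesis using \<open>c > 0\<close> by (simp add: field_simps)
  qed
  ultimately show ?thesis by (simp add: sublinear_def)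
qed

text \<open>A minimal sublinear functional \<open>m\<close> is additive: lowering it along a ray of direction \<open>y\<close>
  gives the sublinear functional \<open>inf\<^sub>t (m (x + t y) - t m y)\<close>, which must coincide with \<open>m\<close>;
  taking \<open>t = 1\<close> yields \<open>m x + m y \<le> m (x + y)\<close>.\<close>

lemma minimal_sublinear_linear:
  fixes m :: "'a::real_vector \<Rightarrow> real"
  assumes m: "sublinear m" and min: "\<And>q. sublinear q \<Longrightarrow> q \<le> m \<Longrightarrow> q = m"
  shows "linear m"
proof -
  have super: "m x + m y \<le> m (x + y)" for x y
  proof -
    define g where "g t x = m (x + t *\<^sub>R y) - t * m y" for t x
    have bdd: "bdd_below ((\<lambda>t. g t x) ` {0..})" for x
    proof (rule bdd_belowI2)
      fix t :: real assume "t \<in> {0..}"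
      then have "t * m y = m (t *\<^sub>R y)" using sublinear_scale[OF m] by simp
      also have "\<dots> \<le> m (x + t *\<^sub>R y) + m (- x)"
        using sublinear_add[OF m, of "x + t *\<^sub>R y" "- x"] by simp
      finally show "- m (- x) \<le> g t x" by (simp add: g_def)
    qed
    have "sublinear (\<lambda>x. INF t\<in>{0..}. g t x)"
    proof (rule sublinear_INF)
      fix s t :: real and x z :: 'a assume "s \<in> {0..}" "t \<in> {0..}"
      moreover have "g (s + t) (x + z) \<le> g s x + g t z"
        using sublinear_add[OF m, of "x + s *\<^sub>R y" "z + t *\<^sub>R y"]
        by (simp add: g_def algebra_simps)
      ultimately show "\<exists>k\<in>{0..}. g k (x + z) \<le> g s x + g t z"
        by (intro bexI[of _ "s + t"]) auto
    next
      fix t c :: real and x :: 'a assume "t \<in> {0..}" "c > 0"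
      moreover from this have "g (c * t) (c *\<^sub>R x) \<le> c * g t x"
        using sublinear_scale[OF m, of c "x + t *\<^sub>R y"] by (simp add: g_def algebra_simps)
      ultimately show "\<exists>k\<in>{0..}. g k (c *\<^sub>R x) \<le> c * g t x"
        by (intro bexI[of _ "c * t"]) auto
    qed (use bdd in auto)
    moreover have "(\<lambda>x. INF t\<in>{0..}. g t x) \<le> m"
    proof (rule le_funI)
      fix x show "(INF t\<in>{0..}. g t x) \<le> m x"
        using cINF_lower[OF bdd, of 0 x] by (simp add: g_def)
    qed
    ultimately have "(\<lambda>x. INF t\<in>{0..}. g t x) = m" by (rule min)
    then have "m x \<le> g 1 x" using cINF_lower[OF bdd, of 1 x] by (metis atLeast_iff zero_le_one)
    then show ?thesis by (simp add: g_def)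
  qed
  have add: "m (x + y) = m x + m y" for x y
    using super[of x y] sublinear_add[OF m, of x y] by simp
  have neg: "m (- x) = - m x" for x
    using add[of x "- x"] sublinear_zero[OF m] by simp
  have "m (c *\<^sub>R x) = c * m x" for c x
  proof (cases "c \<ge> 0")
    case False
    then show ?thesis using sublinear_scale[OF m, of "- c" x] neg[of "c *\<^sub>R x"] by simp
  qed (rule sublinear_scale[OF m])
  then show ?thesis using add by (intro linearI) auto
qed

text \<open>Zorn's lemma supplies a minimal sublinear functional below \<open>p\<close>. Chains have an infimum
  because every sublinear \<open>q \<le> p\<close> satisfies \<open>q x \<ge> - p (- x)\<close>.\<close>

lemma ex_linear_le_sublinear:
  fixes p :: "'a::real_vector \<Rightarrow> real"
  assumes p: "sublinear p"
  shows "\<exists>f. linear f \<and> (\<forall>x. f x \<le> p x)"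
proof -
  let ?A = "{q. sublinear q \<and> q \<le> p}"
  have lower: "- p (- x) \<le> q x" if "q \<in> ?A" for q x
    using that sublinear_uminus_ge[of q x] by (auto simp: le_fun_def) (smt (verit))
  have "\<exists>m\<in>?A. \<forall>a\<in>?A. m \<ge> a \<longrightarrow> a = m"
  proof (rule predicate_Zorn)
    show "partial_order_on ?A (relation_of (\<lambda>x y. x \<ge> y) ?A)"
      by (rule partial_order_on_relation_ofI) auto
  next
    fix Ch assume Ch: "Ch \<in> Chains (relation_of (\<lambda>x y. x \<ge> y) ?A)"
    have sub: "Ch \<subseteq> ?A" and tot: "\<And>q r. q \<in> Ch \<Longrightarrow> r \<in> Ch \<Longrightarrow> q \<le> r \<or> r \<le> q"
      using Ch unfolding Chains_def relation_of_def by auto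
    show "\<exists>u\<in>?A. \<forall>a\<in>Ch. a \<ge> u"
    proof (cases "Ch = {}")
      case True
      then show ?thesis using p by auto
    next
      case False
      have bdd: "bdd_below ((\<lambda>q. q x) ` Ch)" for x
        using sub lower by (intro bdd_belowI2) blast
      let ?u = "\<lambda>x. INF q\<in>Ch. q x"
      have "sublinear ?u"
      proof (rule sublinear_INF[OF False bdd])
        fix q r x y assume qr: "q \<in> Ch" "r \<in> Ch"
        \<comment> \<open>The smaller of the two members of the chain dominates the sum.\<close>
        have "q (x + y) \<le> q x + q y" "r (x + y) \<le> r x + r y"
          using qr sub sublinear_add by blast+
        with tot[OF qr] show "\<exists>k\<in>Ch. k (x + y) \<le> q x + r y"
          using qr unfolding le_fun_def by (smt (verit, best))
      next
        fix q and c :: real and x assume "q \<in> Ch" "c > 0"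
        then show "\<exists>k\<in>Ch. k (c *\<^sub>R x) \<le> c * q x"
          using sub unfolding sublinear_def by blast
      qed
      moreover have le: "?u \<le> q" if "q \<in> Ch" for q
        using cINF_lower[OF bdd that] by (auto simp: le_fun_def)
      moreover have "?u \<le> p"
        using False le sub by (metis (no_types, lifting) all_not_in_conv mem_Collect_eq
            order_trans subsetD)
      ultimately show ?thesis by (intro bexI[of _ ?u]) auto
    qed
  qed
  then obtain m where m: "sublinear m" "m \<le> p" and min: "\<And>q. q \<in> ?A \<Longrightarrow> q \<le> m \<Longrightarrow> q = m"
    by auto
  have "linear m"
  proof (rule minimal_sublinear_linear[OF m(1)])
    fix q assume "sublinear q" "q \<le> m"
    then show "q = m" using min[of q] m(2) by (simp add: order_trans)
  qed
  then show ?thesis using m(2) by (auto simp: le_fun_def)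
qed

text \<open>The functional \<open>p x = inf (\<parallel>x + t w\<parallel> - t \<delta>)\<close>, taken over \<open>t \<ge> 0\<close> and \<open>w \<in> W\<close>, is
  sublinear because \<open>W\<close> is convex and finite because \<open>W\<close> has distance at least \<open>\<delta>\<close> from the origin.
  It lies below the norm and satisfies \<open>p (- w) \<le> - \<delta>\<close>, so a linear functional below \<open>p\<close>
  separates \<open>W\<close> from the origin with margin \<open>\<delta>\<close>; normalising can only enlarge the margin.\<close>

lemma convex_separation_from_zero:
  fixes W :: "'a::real_normed_vector set"
  assumes "convex W" "W \<noteq> {}" "\<delta> > 0" and W: "\<And>w. w \<in> W \<Longrightarrow> \<delta> \<le> norm w"
  shows "\<exists>f :: 'a \<Rightarrow>\<^sub>L real. norm f = 1 \<and> (\<forall>w\<in>W. \<delta> \<le> blinfun_apply f w)"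
proof -
  define g :: "real \<times> 'a \<Rightarrow> 'a \<Rightarrow> real" where "g = (\<lambda>(t, w) x. norm (x + t *\<^sub>R w) - t * \<delta>)"
  let ?I = "{0::real..} \<times> W"
  have bdd: "bdd_below ((\<lambda>i. g i x) ` ?I)" for x
  proof (rule bdd_belowI2)
    fix i assume "i \<in> ?I"
    then obtain t w where i: "i = (t, w)" "t \<ge> 0" "w \<in> W" by auto
    have "t * \<delta> \<le> t * norm w" using i W by (simp add: mult_left_mono)
    also have "\<dots> \<le> norm (x + t *\<^sub>R w) + norm x"
      using norm_triangle_ineq4[of "x + t *\<^sub>R w" x] i by simp
    finally show "- norm x \<le> g i x" by (simp add: g_def i)
  qed
  let ?p = "\<lambda>x. INF i\<in>?I. g i x"
  have "sublinear ?p"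
  proof (rule sublinear_INF[OF _ bdd])
    show "?I \<noteq> {}" using assms by auto
  next
    fix i j x y assume "i \<in> ?I" "j \<in> ?I"
    then obtain s v t w where i: "i = (s, v)" "s \<ge> 0" "v \<in> W" and j: "j = (t, w)" "t \<ge> 0" "w \<in> W"
      by auto
    have "\<exists>u\<in>W. (s + t) *\<^sub>R u = s *\<^sub>R v + t *\<^sub>R w"
    proof (cases "s + t = 0")
      case True
      then have "s = 0" "t = 0" using i(2) j(2) by auto
      then show ?thesis using i by (intro bexI[of _ v]) auto
    next
      case False
      then have "(s / (s + t)) *\<^sub>R v + (t / (s + t)) *\<^sub>R w \<in> W"
        using i j by (intro convexD[OF \<open>convex W\<close>]) (auto simp: add_divide_distrib[symmetric])
      then show ?thesis using False
        by (intro bexI[of _ "(s / (s + t)) *\<^sub>R v + (t / (s + t)) *\<^sub>R w"])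
          (auto simp: scaleR_add_right)
    qed
    then obtain u where u: "u \<in> W" "(s + t) *\<^sub>R u = s *\<^sub>R v + t *\<^sub>R w" by blast
    have "g (s + t, u) (x + y) \<le> g i x + g j y"
      using norm_triangle_ineq[of "x + s *\<^sub>R v" "y + t *\<^sub>R w"] u
      by (simp add: g_def i j algebra_simps)
    then show "\<exists>k\<in>?I. g k (x + y) \<le> g i x + g j y"
      using u i j by (intro bexI[of _ "(s + t, u)"]) auto
  next
    fix i x and c :: real assume "i \<in> ?I" "c > 0"
    then obtain t w where i: "i = (t, w)" "t \<ge> 0" "w \<in> W" by auto
    have "norm (c *\<^sub>R x + (c * t) *\<^sub>R w) = c * norm (x + t *\<^sub>R w)"
      using \<open>c > 0\<close> norm_scaleR[of c "x + t *\<^sub>R w"] by (simp add: scaleR_add_right)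
    then have "g (c * t, w) (c *\<^sub>R x) \<le> c * g i x"
      by (simp add: g_def i algebra_simps)
    then show "\<exists>k\<in>?I. g k (c *\<^sub>R x) \<le> c * g i x"
      using i \<open>c > 0\<close> by (intro bexI[of _ "(c * t, w)"]) auto
  qed
  then obtain h where h: "linear h" "\<And>x. h x \<le> ?p x"
    using ex_linear_le_sublinear by blast
  obtain w0 where w0: "w0 \<in> W" using assms by auto
  have h_le: "h x \<le> norm (x + t *\<^sub>R w) - t * \<delta>" if "t \<ge> 0" "w \<in> W" for x t w
    using h(2)[of x] cINF_lower[OF bdd[of x], of "(t, w)"] that by (simp add: g_def)
  have h_norm: "h x \<le> norm x" for x using h_le[of 0 w0 x] w0 by simp
  have h_W: "\<delta> \<le> h w" if "w \<in> W" for w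
    using h_le[of 1 w "- w"] that linear_neg[OF h(1)] by simp
  have "bounded_linear h"
    using h_norm h_norm[of "- x" for x] linear_neg[OF h(1)]
    by (intro bounded_linear_intro[where K = 1])
      (auto simp: linear_add[OF h(1)] linear_cmul[OF h(1)] abs_le_iff)
  then obtain F :: "'a \<Rightarrow>\<^sub>L real" where F: "\<And>x. F x = h x"
    by (metis bounded_linear_Blinfun_apply)
  have F1: "norm F \<le> 1"
    using h_norm h_norm[of "- x" for x] linear_neg[OF h(1)]
    by (intro norm_blinfun_bound) (auto simp: F abs_le_iff)
  have F0: "F \<noteq> 0" using h_W[OF w0] \<open>\<delta> > 0\<close> F[of w0] by auto
  have "\<delta> \<le> (inverse (norm F) *\<^sub>R F) w" if "w \<in> W" for w
  proof -
    have "\<delta> * norm F \<le> \<delta>" using F1 \<open>\<delta> > 0\<close> by (simp add: mult_left_le)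
    also have "\<dots> \<le> F w" using h_W[OF that] by (simp add: F)
    finally show ?thesis using F0 by (simp add: blinfun.scaleR_left field_simps)
  qed
  then show ?thesis using F0 by (intro exI[of _ "inverse (norm F) *\<^sub>R F"]) auto
qed

section \<open>Strict separation of cones by a functional\<close>

lemma mem_cone_normalise:
  fixes x :: "'a::real_normed_vector"
  assumes "cone P" "x \<in> P"
  shows "x /\<^sub>R norm x \<in> P"
  using assms by (simp add: cone_def)

lemma frontier_cone_scale:
  fixes Q :: "'a::real_normed_vector set"
  assumes "cone Q" "x \<in> frontier Q" "c > 0"
  shows "c *\<^sub>R x \<in> frontier Q"
proof -
  have inv: "y \<in> Q" if "c *\<^sub>R y \<in> Q" for y
  proof -
    have "inverse c *\<^sub>R c *\<^sub>R y \<in> Q" using mem_cone[OF assms(1) that, of "inverse c"] assms(3) by simp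
    then show ?thesis using assms by simp
  qed
  have "c *\<^sub>R y \<in> Q" if "y \<in> Q" for y
    using assms(1,3) that by (simp add: cone_def)
  then have "(*\<^sub>R) c ` Q \<subseteq> Q" "(*\<^sub>R) c ` (- Q) \<subseteq> - Q"
    using inv by blast+
  then have "(*\<^sub>R) c ` closure Q \<subseteq> closure Q" "(*\<^sub>R) c ` closure (- Q) \<subseteq> closure (- Q)"
    by (simp_all add: closure_mono closure_scaleR)
  then show ?thesis using assms(2) by (auto simp: frontier_closures)
qed

text \<open>Since \<open>0\<close> belongs to the second set of the SSP, the supremum \<open>\<beta>\<close> of \<open>f\<close> over that set is
  nonnegative; \<open>\<delta>\<close> bounds from below the norms of the differences in the SSP. Homogeneity
  extends the estimates from unit vectors to the cones, and \<open>\<beta> + \<delta> \<le> 1\<close> because \<open>f\<close> has norm one.\<close>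

lemma SSP_separating_functional:
  fixes P Q :: "'a::real_normed_vector set"
  assumes "SSP P Q" "cone P" "\<exists>x\<in>P. x \<noteq> 0" "cone Q"
  shows "\<exists>(f :: 'a \<Rightarrow>\<^sub>L real) \<beta> \<delta>. norm f = 1 \<and> 0 \<le> \<beta> \<and> 0 < \<delta> \<and> \<beta> + \<delta> \<le> 1 \<and>
    (\<forall>x\<in>P. (\<beta> + \<delta>) * norm x \<le> blinfun_apply f x) \<and> (\<forall>y\<in>frontier Q. blinfun_apply f y \<le> \<beta> * norm y)"
proof -
  let ?A = "convex hull (P \<inter> sphere 0 1)"
  let ?B = "convex hull ((frontier Q \<inter> sphere 0 1) \<union> {0})"
  let ?W = "{x - y | x y. x \<in> ?A \<and> y \<in> ?B}"
  obtain x0 where "x0 \<in> P" "x0 \<noteq> 0" using assms by blast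
  then have a0: "x0 /\<^sub>R norm x0 \<in> P \<inter> sphere 0 1"
    using mem_cone_normalise[OF \<open>cone P\<close>] by auto
  then have a0A: "x0 /\<^sub>R norm x0 \<in> ?A" by (rule hull_inc)
  have 0: "0 \<in> ?B" by (rule hull_inc) simp
  obtain \<delta> where \<delta>: "\<delta> > 0" "\<And>w. w \<in> ?W \<Longrightarrow> \<delta> \<le> norm w"
  proof -
    have "0 \<notin> closure ?W" using assms(1) by (simp add: SSP_def)
    then obtain e where "e > 0" "\<forall>w\<in>?W. \<not> dist w 0 < e"
      unfolding closure_approachable by blast
    then show thesis using that[of e] by (simp add: not_less)
  qed
  have W_eq: "?W = (\<Union>x\<in>?A. \<Union>y\<in>?B. {x - y})" by auto
  have conv: "convex ?W"
    unfolding W_eq by (intro convex_differences convex_convex_hull)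
  have ne: "?W \<noteq> {}" using a0A 0 by blast
  obtain f :: "'a \<Rightarrow>\<^sub>L real" where f: "norm f = 1" "\<And>w. w \<in> ?W \<Longrightarrow> \<delta> \<le> f w"
    using convex_separation_from_zero[OF conv ne \<delta>] by blast
  have sep: "f y \<le> f x - \<delta>" if "x \<in> ?A" "y \<in> ?B" for x y
    using f(2)[of "x - y"] that by (fastforce simp: blinfun.diff_right)
  define \<beta> where "\<beta> = (SUP y\<in>?B. f y)"
  have bdd: "bdd_above (f ` ?B)" using sep[OF a0A] by (intro bdd_aboveI2) auto
  have B: "f y \<le> \<beta>" if "y \<in> ?B" for y
    unfolding \<beta>_def by (rule cSUP_upper[OF that bdd])
  have A: "\<beta> + \<delta> \<le> f x" if "x \<in> ?A" for x
  proof -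
    have "\<beta> \<le> f x - \<delta>" unfolding \<beta>_def using sep[OF that] 0 by (intro cSUP_least) auto
    then show ?thesis by simp
  qed
  have "0 \<le> \<beta>" using B[OF 0] by simp
  have "f (x0 /\<^sub>R norm x0) \<le> 1"
    using norm_blinfun[of f "x0 /\<^sub>R norm x0"] f(1) a0 by simp
  then have le1: "\<beta> + \<delta> \<le> 1" using A[OF a0A] by simp
  have P: "(\<beta> + \<delta>) * norm x \<le> f x" if "x \<in> P" for x
  proof (cases "x = 0")
    case False
    then have "x /\<^sub>R norm x \<in> P \<inter> sphere 0 1"
      using mem_cone_normalise[OF \<open>cone P\<close> that] by auto
    then have "\<beta> + \<delta> \<le> f (x /\<^sub>R norm x)" by (intro A hull_inc)
    then show ?thesis using False by (simp add: blinfun.scaleR_right field_simps)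
  qed simp
  have Q: "f y \<le> \<beta> * norm y" if "y \<in> frontier Q" for y
  proof (cases "y = 0")
    case False
    then have "y /\<^sub>R norm y \<in> frontier Q \<inter> sphere 0 1"
      using frontier_cone_scale[OF \<open>cone Q\<close> that, of "inverse (norm y)"] by simp
    then have "f (y /\<^sub>R norm y) \<le> \<beta>" by (intro B hull_inc) blast
    then show ?thesis using False by (simp add: blinfun.scaleR_right field_simps)
  qed simp
  show ?thesis using f(1) \<open>0 \<le> \<beta>\<close> \<delta>(1) le1 P Q by blast
qed

section \<open>Superlevel cones and interior reductions\<close>

lemma convex_superlevel_functional_norm:
  fixes f :: "'a::real_normed_vector \<Rightarrow>\<^sub>L real"
  assumes "\<alpha> \<ge> 0"
  shows "convex {z. c \<le> f z - \<alpha> * norm z}" and "convex {z. c < f z - \<alpha> * norm z}"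
proof -
  have concave: "u * (f x - \<alpha> * norm x) + v * (f y - \<alpha> * norm y)
      \<le> f (u *\<^sub>R x + v *\<^sub>R y) - \<alpha> * norm (u *\<^sub>R x + v *\<^sub>R y)"
    if "u \<ge> 0" "v \<ge> 0" for u v x y
  proof -
    have "norm (u *\<^sub>R x + v *\<^sub>R y) \<le> u * norm x + v * norm y"
      using norm_triangle_ineq[of "u *\<^sub>R x" "v *\<^sub>R y"] that by simp
    from mult_left_mono[OF this assms] show ?thesis
      by (simp add: blinfun.add_right blinfun.scaleR_right algebra_simps)
  qed
  have bound: "c \<le> u * a + v * b" if "c \<le> a" "c \<le> b" "0 \<le> u" "0 \<le> v" "u + v = 1" for u v a b
    using convex_bound_le[of "- a" "- c" "- b" u v] that by simp
  show "convex {z. c \<le> f z - \<alpha> * norm z}"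
  proof (intro convexI CollectI)
    fix x y and u v :: real
    assume "x \<in> {z. c \<le> f z - \<alpha> * norm z}" "y \<in> {z. c \<le> f z - \<alpha> * norm z}"
      and uv: "0 \<le> u" "0 \<le> v" "u + v = 1"
    then have "c \<le> u * (f x - \<alpha> * norm x) + v * (f y - \<alpha> * norm y)"
      unfolding mem_Collect_eq by (intro bound)
    also note concave[OF uv(1,2)]
    finally show "c \<le> f (u *\<^sub>R x + v *\<^sub>R y) - \<alpha> * norm (u *\<^sub>R x + v *\<^sub>R y)" .
  qed
  have bound: "c < u * a + v * b" if "c < a" "c < b" "0 \<le> u" "0 \<le> v" "u + v = 1" for u v a b
    using convex_bound_lt[of "- a" "- c" "- b" u v] that by simp
  show "convex {z. c < f z - \<alpha> * norm z}"
  proof (intro convexI CollectI)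
    fix x y and u v :: real
    assume "x \<in> {z. c < f z - \<alpha> * norm z}" "y \<in> {z. c < f z - \<alpha> * norm z}"
      and uv: "0 \<le> u" "0 \<le> v" "u + v = 1"
    then have "c < u * (f x - \<alpha> * norm x) + v * (f y - \<alpha> * norm y)"
      unfolding mem_Collect_eq by (intro bound)
    also note concave[OF uv(1,2)]
    finally show "c < f (u *\<^sub>R x + v *\<^sub>R y) - \<alpha> * norm (u *\<^sub>R x + v *\<^sub>R y)" .
  qed
qed

text \<open>For \<open>\<epsilon> < 1\<close>, points of \<open>cone ((bd Q \<inter> S) + \<epsilon> B)\<close> satisfy \<open>(1 - \<epsilon>) f z \<le> (\<beta> + \<epsilon>) \<parallel>z\<parallel>\<close>, so for small
  \<open>\<epsilon>\<close> they stay outside the superlevel cone of any slope \<open>\<alpha> > \<beta>\<close>. A convex set that meets \<open>Q\<close>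
  but not its boundary lies in \<open>Q\<close>.\<close>

lemma superlevel_cone_subset_cone_reduction:
  fixes f :: "'a::real_normed_vector \<Rightarrow>\<^sub>L real"
  assumes "norm f \<le> 1" "0 \<le> \<beta>" "\<beta> < \<alpha>" "\<alpha> \<le> 1"
    and fr: "\<And>y. y \<in> frontier Q \<Longrightarrow> f y \<le> \<beta> * norm y"
    and meets: "z0 \<in> Q" "\<alpha> * norm z0 < f z0"
  shows "\<exists>\<epsilon>>0. {z. \<alpha> * norm z < f z} \<subseteq> cone_reduction \<epsilon> Q"
proof -
  let ?D = "{z. \<alpha> * norm z < f z}"
  \<comment> \<open>With this choice \<open>\<beta> + \<epsilon> \<le> \<alpha> (1 - \<epsilon>)\<close>, because \<open>\<alpha> \<le> 1\<close>.\<close>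
  define \<epsilon> where "\<epsilon> = (\<alpha> - \<beta>) / 2"
  have \<epsilon>: "\<epsilon> > 0" using assms by (simp add: \<epsilon>_def)
  have "\<alpha> * \<epsilon> \<le> \<epsilon>" using \<epsilon> \<open>\<alpha> \<le> 1\<close> by simp
  then have \<epsilon>2: "\<beta> + \<epsilon> \<le> \<alpha> * (1 - \<epsilon>)" by (simp add: \<epsilon>_def field_simps)
  have "convex ?D" using convex_superlevel_functional_norm(2)[of \<alpha> 0 f] assms by simp
  moreover have "?D \<inter> frontier Q = {}"
  proof -
    have "f y \<le> \<alpha> * norm y" if "y \<in> frontier Q" for y
    proof -
      have "\<beta> * norm y \<le> \<alpha> * norm y" using \<open>\<beta> < \<alpha>\<close> by (intro mult_right_mono) auto
      then show ?thesis using fr[OF that] by simp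
    qed
    then show ?thesis by fastforce
  qed
  moreover have "?D \<inter> Q \<noteq> {}"
    using meets by blast
  ultimately have "?D - Q = {}"
    using connected_Int_frontier[of ?D Q] convex_connected[of ?D] by metis
  then have DQ: "?D \<subseteq> Q" by simp
  have "\<not> \<alpha> * norm z < f z"
    if z: "z \<in> cone hull {x + \<epsilon> *\<^sub>R u | x u. x \<in> frontier Q \<inter> sphere 0 1 \<and> u \<in> ball 0 1}" for z
  proof -
    obtain c x u where c: "c \<ge> 0" and zz: "z = c *\<^sub>R (x + \<epsilon> *\<^sub>R u)" and x: "x \<in> frontier Q" "norm x = 1"
      and u: "norm u < 1"
      using z unfolding cone_hull_expl by auto
    have "f u \<le> norm f * norm u" using norm_blinfun[of f u] by simp
    also have "\<dots> \<le> 1" using assms(1) u by (simp add: mult_le_one)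
    finally have "\<epsilon> * f u \<le> \<epsilon>" using \<epsilon> by simp
    then have "f (x + \<epsilon> *\<^sub>R u) \<le> \<beta> + \<epsilon>"
      using fr[OF x(1)] x(2) by (simp add: blinfun.add_right blinfun.scaleR_right)
    also have "\<dots> \<le> \<alpha> * norm (x + \<epsilon> *\<^sub>R u)"
    proof -
      have "\<epsilon> * norm u \<le> \<epsilon>" using \<epsilon> u by simp
      moreover have "norm (\<epsilon> *\<^sub>R u) = \<epsilon> * norm u" using \<epsilon> by simp
      moreover have "norm x - norm (\<epsilon> *\<^sub>R u) \<le> norm (x + \<epsilon> *\<^sub>R u)" by (rule norm_diff_ineq)
      ultimately have "1 - \<epsilon> \<le> norm (x + \<epsilon> *\<^sub>R u)" using x(2) by linarith
      then have "\<alpha> * (1 - \<epsilon>) \<le> \<alpha> * norm (x + \<epsilon> *\<^sub>R u)"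
        using assms by (intro mult_left_mono) auto
      then show ?thesis using \<epsilon>2 by simp
    qed
    finally have "c * f (x + \<epsilon> *\<^sub>R u) \<le> c * (\<alpha> * norm (x + \<epsilon> *\<^sub>R u))"
      using c by (rule mult_left_mono)
    then show ?thesis using c by (simp add: zz blinfun.scaleR_right mult_ac)
  qed
  then have "?D \<subseteq> cone_reduction \<epsilon> Q"
    using DQ unfolding cone_reduction_def by blast
  then show ?thesis using \<epsilon> by blast
qed

text \<open>Regularity makes the reduction of \<open>K\<close> hit the sphere of radius \<open>t\<close> in every one of its
  directions, so co-radiance fills each such ray from norm \<open>t\<close> on. Openness of \<open>D\<close> turns
  membership in \<open>K\<close> into membership in its interior.\<close>

lemma regular_coradiant_contains_far_points:
  fixes K :: "'a::real_normed_vector set"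
  assumes K: "coradiant K" "coradiant_regular K" and "\<epsilon> > 0"
    and D: "open D" "D \<noteq> {}" "0 \<notin> D" "\<And>z c. z \<in> D \<Longrightarrow> c > 0 \<Longrightarrow> c *\<^sub>R z \<in> D"
    and sub: "D \<subseteq> cone_reduction \<epsilon> (cone hull K)"
  shows "\<exists>t>0. \<forall>z\<in>D. t < norm z \<longrightarrow> z \<in> interior K"
proof -
  have dir: "\<exists>l>0. \<exists>a\<in>coradiant_reduction \<epsilon> K. z = l *\<^sub>R a" if z: "z \<in> D" for z
  proof -
    have "z \<in> cone hull K" using sub z by (auto simp: cone_reduction_def)
    then obtain l a where la: "z = l *\<^sub>R a" "l \<ge> 0" "a \<in> K" unfolding cone_hull_expl by blast
    have l: "l > 0" using la z D(3) by (cases "l = 0") auto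
    then have "a = inverse l *\<^sub>R z" using la by simp
    then have "a \<in> D" using D(4)[OF z, of "inverse l"] l by simp
    then have "a \<in> coradiant_reduction \<epsilon> K"
      using la sub by (auto simp: coradiant_reduction_def)
    then show ?thesis using la l by blast
  qed
  then have "coradiant_reduction \<epsilon> K \<noteq> {}" using \<open>D \<noteq> {}\<close> by blast
  then obtain t where t: "t > 0" "is_norm_base (coradiant_reduction \<epsilon> K) t"
    using K(2) \<open>\<epsilon> > 0\<close> unfolding coradiant_regular_def admits_norm_base_def by blast
  have far: "z \<in> K" if z: "z \<in> D" "t < norm z" for z
  proof -
    obtain l a where la: "l > 0" "a \<in> coradiant_reduction \<epsilon> K" "z = l *\<^sub>R a" using dir[OF z(1)] by blast
    then obtain y k where y: "y \<in> coradiant_reduction \<epsilon> K" "norm y = t" "k > 0" "a = k *\<^sub>R y"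
      using t(2) unfolding is_norm_base_def by fastforce
    have zy: "z = (l * k) *\<^sub>R y" using la y by simp
    then have "t < (l * k) * t" using z(2) y la by (simp add: mult_ac)
    then have "l * k \<ge> 1" using t(1) by simp
    moreover have "y \<in> K" using y by (simp add: coradiant_reduction_def)
    ultimately show ?thesis using K(1) unfolding coradiant_def zy by blast
  qed
  have "open (D \<inter> {z. t < norm z})"
    by (intro open_Int D open_Collect_less continuous_intros)
  then have "D \<inter> {z. t < norm z} \<subseteq> interior K"
    using far by (intro interior_maximal) auto
  then show ?thesis using t(1) by blast
qed

section \<open>Separation of co-radiant sets\<close>

lemma profile_inf_le_norm:
  fixes C :: "'a::real_normed_vector set"
  assumes "x \<in> C" "x \<noteq> 0"
  shows "profile_inf C \<le> ennreal (norm x)"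
proof -
  let ?u = "x /\<^sub>R norm x"
  have le: "radial_profile C ?u \<le> ennreal (norm x)"
    unfolding radial_profile_def by (rule Inf_lower) (use assms in auto)
  then have "?u \<in> profile_dom C"
    using assms le_less_trans[OF le ennreal_less_top] by (simp add: profile_dom_def)
  then have "profile_inf C \<le> radial_profile C ?u"
    unfolding profile_inf_def by (rule INF_lower)
  with le show ?thesis by (rule order_trans[rotated])
qed

lemma coradiant_norm_bounded_below:
  fixes C :: "'a::real_normed_vector set"
  assumes "coradiant C" "profile_inf C > 0"
  shows "\<exists>d>0. \<forall>x\<in>C. d \<le> norm x"
proof -
  obtain x0 where "x0 \<in> C" and nz: "\<And>x. x \<in> C \<Longrightarrow> x \<noteq> 0"
    using assms(1) by (auto simp: coradiant_def)
  then have fin: "profile_inf C < top"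
    using profile_inf_le_norm[of x0 C] le_less_trans ennreal_less_top by blast
  have "enn2real (profile_inf C) > 0"
    using assms(2) fin by (simp add: enn2real_positive_iff)
  moreover have "enn2real (profile_inf C) \<le> norm x" if "x \<in> C" for x
    using enn2real_mono[OF profile_inf_le_norm[OF that nz[OF that]]] by simp
  ultimately show ?thesis by blast
qed

theorem theorem6p1:
  fixes C K :: "'a::real_normed_vector set"
  assumes "coradiant C" and "coradiant K"
    and "profile_inf C * profile_inf K > 0"
    and "coradiant_regular K"
    and "closure (convex hull C) \<inter> interior K \<noteq> {}"
    and "SSP (cone hull C) (cone hull K)"
  shows "\<exists>\<alpha>1 \<alpha>2 :: real. \<exists>f :: 'a \<Rightarrow>\<^sub>L real.
    0 < \<alpha>1 \<and> \<alpha>1 < \<alpha>2 \<and> \<alpha>2 < 1 \<and> norm f = 1 \<and>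
    (let V = {blinfun_apply f y - \<alpha> * norm y | y \<alpha>. y \<in> C \<and> \<alpha> \<in> {\<alpha>1<..<\<alpha>2}};
         lam = Inf V
     in bdd_below V \<and> lam > 0 \<and>
        (\<exists>\<eta>0>0. \<forall>\<eta>\<in>{0<..<\<eta>0}. \<forall>\<alpha>\<in>{\<alpha>1<..<\<alpha>2}.
           \<forall>y'\<in>UNIV - interior ((\<lambda>x. \<eta> *\<^sub>R x) ` K). \<forall>y\<in>closure (convex hull C).
             blinfun_apply f y' - \<alpha> * norm y' < \<eta> / \<eta>0 * lam \<and>
             \<eta> / \<eta>0 * lam < lam \<and>
             lam < blinfun_apply f y - \<alpha> * norm y))"
proof -
  obtain x0 where x0: "x0 \<in> C" "x0 \<noteq> 0"
    using assms(1) by (auto simp: coradiant_def)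
  have CQ: "C \<subseteq> cone hull C" by (rule hull_subset)
  then have "\<exists>x\<in>cone hull C. x \<noteq> 0" using x0 by blast
  then obtain f :: "'a \<Rightarrow>\<^sub>L real" and \<beta> \<delta> where f: "norm f = 1"
    and \<beta>\<delta>: "0 \<le> \<beta>" "0 < \<delta>" "\<beta> + \<delta> \<le> 1"
    and fC: "\<And>x. x \<in> cone hull C \<Longrightarrow> (\<beta> + \<delta>) * norm x \<le> f x"
    and fK: "\<And>y. y \<in> frontier (cone hull K) \<Longrightarrow> f y \<le> \<beta> * norm y"
    using SSP_separating_functional[OF assms(6) cone_cone_hull _ cone_cone_hull] by blast
  have "profile_inf C > 0" using assms(3) by (simp add: zero_less_iff_neq_zero)
  then obtain d where d: "d > 0" "\<And>x. x \<in> C \<Longrightarrow> d \<le> norm x"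
    using coradiant_norm_bounded_below[OF assms(1)] by blast
  define \<alpha>1 where "\<alpha>1 = \<beta> + \<delta> / 3"
  define \<alpha>2 where "\<alpha>2 = \<beta> + 2 * \<delta> / 3"
  have \<alpha>: "0 < \<alpha>1" "\<beta> < \<alpha>1" "\<alpha>1 < \<alpha>2" "\<alpha>2 < \<beta> + \<delta>" "\<alpha>2 < 1"
    using \<beta>\<delta> by (auto simp: \<alpha>1_def \<alpha>2_def)
  define V where "V = {f y - \<alpha> * norm y | y \<alpha>. y \<in> C \<and> \<alpha> \<in> {\<alpha>1<..<\<alpha>2}}"
  define lam where "lam = Inf V"
  have V_ge: "(\<beta> + \<delta> - \<alpha>2) * d \<le> v" if "v \<in> V" for v
  proof -
    obtain y \<alpha> where y: "v = f y - \<alpha> * norm y" "y \<in> C" "\<alpha> < \<alpha>2"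
      using \<open>v \<in> V\<close> by (auto simp: V_def)
    have "(\<beta> + \<delta> - \<alpha>2) * d \<le> (\<beta> + \<delta> - \<alpha>) * norm y"
      using d(1) d(2)[OF y(2)] y(3) \<alpha> by (intro mult_mono) auto
    also have "\<dots> \<le> v" using fC[of y] y CQ by (auto simp: algebra_simps)
    finally show ?thesis .
  qed
  have bddV: "bdd_below V" using V_ge by (rule bdd_belowI)
  have "f x0 - ((\<alpha>1 + \<alpha>2) / 2) * norm x0 \<in> V"
    unfolding V_def mem_Collect_eq using x0(1) \<alpha>(3)
    by (intro exI[of _ x0] exI[of _ "(\<alpha>1 + \<alpha>2) / 2"]) auto
  then have "(\<beta> + \<delta> - \<alpha>2) * d \<le> lam"
    unfolding lam_def using V_ge by (intro cInf_greatest) auto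
  moreover have "(\<beta> + \<delta> - \<alpha>2) * d > 0" using \<alpha>(4) d(1) by simp
  ultimately have lam: "lam > 0" by linarith
  have hull_ge: "lam \<le> f y - \<alpha> * norm y" if "y \<in> closure (convex hull C)" "\<alpha>1 < \<alpha>" "\<alpha> < \<alpha>2" for y \<alpha>
  proof -
    let ?L = "{z. lam \<le> f z - \<alpha> * norm z}"
    have "C \<subseteq> ?L"
      using that bddV unfolding lam_def by (auto simp: V_def intro!: cInf_lower)
    moreover have "convex ?L"
      using that \<alpha> by (intro convex_superlevel_functional_norm) simp
    moreover have "closed ?L"
      by (intro closed_Collect_le continuous_intros)
    ultimately show ?thesis using that(1) 
      by (metis (lifting) closure_minimal hull_minimal mem_Collect_eq subsetD)
  qed
  \<comment> \<open>Strictness: the same bound holds for a slope strictly between \<open>\<alpha>\<close> and \<open>\<alpha>2\<close>.\<close>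
  have hull_gt: "lam < f y - \<alpha> * norm y"
    if y: "y \<in> closure (convex hull C)" and "\<alpha>1 < \<alpha>" "\<alpha> < \<alpha>2" for y \<alpha>
  proof -
    have ge: "lam \<le> f y - ((\<alpha> + \<alpha>2) / 2) * norm y" using that by (intro hull_ge) auto
    then have "y \<noteq> 0" using lam by auto
    then have "\<alpha> * norm y < ((\<alpha> + \<alpha>2) / 2) * norm y" using that by simp
    then show ?thesis using ge by linarith
  qed
  let ?D = "{z. \<alpha>1 * norm z < f z}"
  obtain z0 where z0: "z0 \<in> closure (convex hull C)" "z0 \<in> interior K" using assms(5) by blast
  have z0Q: "z0 \<in> cone hull K" using z0(2) interior_subset hull_subset by (metis subsetD)
  have z0D: "\<alpha>1 * norm z0 < f z0"
  proof -
    have "\<alpha>1 * norm z0 \<le> ((\<alpha>1 + \<alpha>2) / 2) * norm z0" using \<alpha> by (intro mult_right_mono) auto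
    moreover have "lam \<le> f z0 - ((\<alpha>1 + \<alpha>2) / 2) * norm z0" using z0(1) \<alpha> by (intro hull_ge) auto
    ultimately show ?thesis using lam by linarith
  qed
  obtain \<epsilon> where \<epsilon>: "\<epsilon> > 0" "?D \<subseteq> cone_reduction \<epsilon> (cone hull K)"
    using superlevel_cone_subset_cone_reduction[of f \<beta> \<alpha>1 "cone hull K", OF _ _ _ _ fK z0Q z0D]
      f \<beta>\<delta>(1) \<alpha> by auto
  have "\<exists>t>0. \<forall>z\<in>?D. t < norm z \<longrightarrow> z \<in> interior K"
  proof (rule regular_coradiant_contains_far_points[OF assms(2,4) \<epsilon>(1) _ _ _ _ \<epsilon>(2)])
    show "open ?D" by (intro open_Collect_less continuous_intros)
    show "?D \<noteq> {}" using z0D by blast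
    show "c *\<^sub>R z \<in> ?D" if "z \<in> ?D" "c > 0" for z c
    proof -
      have "c * (\<alpha>1 * norm z) < c * f z" using that by simp
      then show ?thesis using that by (simp add: blinfun.scaleR_right mult_ac)
    qed
  qed simp
  then obtain t where t: "t > 0" "\<And>z. z \<in> ?D \<Longrightarrow> t < norm z \<Longrightarrow> z \<in> interior K" by blast
  have outside: "f z - \<alpha> * norm z \<le> t" if z: "z \<notin> interior K" and "\<alpha>1 < \<alpha>" for z \<alpha>
  proof (cases "z \<in> ?D")
    case True
    then have "norm z \<le> t" using t(2) z by fastforce
    moreover have "f z \<le> norm z" using norm_blinfun[of f z] f by simp
    moreover have "0 \<le> \<alpha> * norm z" using \<alpha> that by simp
    ultimately show ?thesis by linarith
  next
    case False
    moreover have "\<alpha>1 * norm z \<le> \<alpha> * norm z" using that by (intro mult_right_mono) auto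
    ultimately show ?thesis using t(1) by simp
  qed
  \<comment> \<open>The summand 1 turns the bound \<open>t\<close> into a strict one.\<close>
  define \<eta>0 where "\<eta>0 = lam / (t + 1)"
  have \<eta>0: "\<eta>0 > 0" using lam t by (simp add: \<eta>0_def)
  have below: "f y' - \<alpha> * norm y' < \<eta> / \<eta>0 * lam"
    if \<eta>: "0 < \<eta>" and "\<alpha>1 < \<alpha>" and y': "y' \<notin> interior ((\<lambda>x. \<eta> *\<^sub>R x) ` K)" for \<eta> \<alpha> y'
  proof -
    define z where "z = inverse \<eta> *\<^sub>R y'"
    have y'z: "y' = \<eta> *\<^sub>R z" using \<eta> by (simp add: z_def)
    have "(*\<^sub>R) \<eta> ` interior K \<subseteq> interior ((\<lambda>x. \<eta> *\<^sub>R x) ` K)"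
      using \<eta> by (intro interior_maximal image_mono interior_subset open_scaling) auto
    then have "z \<notin> interior K" using y' unfolding y'z by blast
    then have "f z - \<alpha> * norm z < t + 1" using outside[of z \<alpha>] that by simp
    then have "\<eta> * (f z - \<alpha> * norm z) < \<eta> * (t + 1)" using \<eta> by simp
    moreover have "\<eta> / \<eta>0 * lam = \<eta> * (t + 1)" using lam t by (simp add: \<eta>0_def)
    moreover have "\<eta> * (f z - \<alpha> * norm z) = f y' - \<alpha> * norm y'"
      using \<eta> by (simp add: y'z blinfun.scaleR_right algebra_simps)
    ultimately show ?thesis by simp
  qed
  have mid: "\<eta> / \<eta>0 * lam < lam" if "\<eta> < \<eta>0" for \<eta>
    using mult_strict_right_mono[of "\<eta> / \<eta>0" 1 lam] that \<eta>0 lam by simp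
  show ?thesis
  proof (intro exI conjI)
    show "let V = {f y - \<alpha> * norm y | y \<alpha>. y \<in> C \<and> \<alpha> \<in> {\<alpha>1<..<\<alpha>2}}; lam = Inf V
     in bdd_below V \<and> lam > 0 \<and>
        (\<exists>\<eta>0>0. \<forall>\<eta>\<in>{0<..<\<eta>0}. \<forall>\<alpha>\<in>{\<alpha>1<..<\<alpha>2}.
           \<forall>y'\<in>UNIV - interior ((\<lambda>x. \<eta> *\<^sub>R x) ` K). \<forall>y\<in>closure (convex hull C).
             f y' - \<alpha> * norm y' < \<eta> / \<eta>0 * lam \<and> \<eta> / \<eta>0 * lam < lam \<and>
             lam < f y - \<alpha> * norm y)"
      unfolding Let_def V_def[symmetric] lam_def[symmetric]
      using bddV lam \<eta>0 below mid hull_gt by (intro conjI exI[of _ \<eta>0]) auto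
  qed (use \<alpha> f in auto)
qed

end
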